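(* Let $X \subseteq [\omega]^\omega$ be downward-closed with respect to almost-inclusion. Then $X$ is meager (as a subset of $2^\omega$) if and only if $X$ is not groupwise dense.
   Context: $2^\omega$ is the space of infinite sequences of zeros and ones with the product topology (two-point discrete factors); meager means first category in this topology. Subsets of $\omega$ are identified with their characteristic functions, and $[\omega]^\omega \subseteq 2^\omega$ is the set of infinite subsets of $\omega$. For $x,y \subseteq \omega$, write $x \le y$ if $x$ is almost included in $y$, i.e. $x - y$ is finite. A set $X \subseteq [\omega]^\omega$ is downward-closed if whenever $x \in X$, $y \in [\omega]^\omega$ and $y \le x$, then $y \in X$. A set $G \subseteq [\omega]^\omega$ is groupwise dense if it is downward-closed and, for every partition of $\omega$ into finite (nonempty) intervals, the union of some infinitely many of the intervals belongs to $G$. *)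

theory Defs
  imports "HOL-Analysis.Analysis" "HOL-Library.Disjoint_Sets"
begin

definition nowhere_dense :: "'a::topological_space set \<Rightarrow> bool" where
  "nowhere_dense S \<longleftrightarrow> interior (closure S) = {}"

definition meager :: "'a::topological_space set \<Rightarrow> bool" where
  "meager S \<longleftrightarrow> (\<exists>\<N>. countable \<N> \<and> (\<forall>N\<in>\<N>. nowhere_dense N) \<and> S = \<Union>\<N>)"

text \<open>Cantor space is the type \<^typ>\<open>nat \<Rightarrow> bool\<close>: \<^typ>\<open>bool\<close> carries the discrete topology, and
  the library topology on a function type is the product topology. Subsets of the natural
  numbers enter it through their characteristic functions.\<close>

definition char_fun :: "nat set \<Rightarrow> (nat \<Rightarrow> bool)" where
  "char_fun x = (\<lambda>n. n \<in> x)"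

definition almost_subset :: "nat set \<Rightarrow> nat set \<Rightarrow> bool" where
  "almost_subset x y \<longleftrightarrow> finite (x - y)"

definition downward_closed :: "nat set set \<Rightarrow> bool" where
  "downward_closed X \<longleftrightarrow>
     X \<subseteq> {x. infinite x} \<and>
     (\<forall>x\<in>X. \<forall>y. infinite y \<and> almost_subset y x \<longrightarrow> y \<in> X)"

text \<open>The intervals are nonempty because \<^const>\<open>partition_on\<close> excludes empty blocks.\<close>

definition interval_partition :: "nat set set \<Rightarrow> bool" where
  "interval_partition P \<longleftrightarrow> partition_on UNIV P \<and> (\<forall>I\<in>P. \<exists>a b. I = {a..<b})"

definition groupwise_dense :: "nat set set \<Rightarrow> bool" where
  "groupwise_dense G \<longleftrightarrow>
     downward_closed G \<and>
     (\<forall>P. interval_partition P \<longrightarrow> (\<exists>Q\<subseteq>P. infinite Q \<and> \<Union>Q \<in> G))"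

end

(* If some interval partition has no infinite union of blocks in X, then each member of the
   downward-closed set X contains only finitely many blocks, so X is covered by the sets of those x
   containing no block beyond n, and these are nowhere dense. Conversely, if X is the union of an
   increasing sequence of nowhere dense sets M k, choose intervals I k and nonempty patterns
   t k \<subseteq> I k such that every set with trace t k on I k lies outside M k. If an infinite union of
   blocks I k belonged to X, then so would the union of the corresponding t k, which lies in no M k. *)
theory Submission
  imports Defs
begin

section \<open>Cylinders and nowhere dense sets in sequence spaces\<close>

definition cylinder :: "(nat \<Rightarrow> 'a) \<Rightarrow> nat \<Rightarrow> (nat \<Rightarrow> 'a) set" where
  "cylinder f m = {h. \<forall>i<m. h i = f i}"

lemma cylinder_self [simp]: "f \<in> cylinder f m"
  by (simp add: cylinder_def)

lemma open_cylinder: "open (cylinder (f :: nat \<Rightarrow> 'a::discrete_topology) m)"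
proof -
  have "cylinder f m = Pi\<^sub>E UNIV (\<lambda>i. if i < m then {f i} else UNIV)"
    by (auto simp: cylinder_def PiE_def Pi_def split: if_splits)
  moreover have "finite {i. (if i < m then {f i} else UNIV) \<noteq> UNIV}"
    by (rule finite_subset[of _ "{..<m}"]) auto
  ultimately show ?thesis
    by (auto intro!: open_PiE simp: open_discrete)
qed

lemma open_contains_cylinder:
  fixes U :: "(nat \<Rightarrow> 'a::topological_space) set"
  assumes "open U" "f \<in> U"
  obtains m where "cylinder f m \<subseteq> U"
proof -
  obtain V where V: "f \<in> Pi\<^sub>E UNIV V" "finite {i. V i \<noteq> UNIV}" "Pi\<^sub>E UNIV V \<subseteq> U"
    using product_topology_open_contains_basis[of "\<lambda>_. euclidean" UNIV U f] assms
    by (auto simp: open_fun_def)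
  \<comment> \<open>A basic open set constrains finitely many coordinates, and \<open>m\<close>
    bounds them all.\<close>
  obtain m where m: "\<forall>i\<in>{i. V i \<noteq> UNIV}. i < m"
    using V(2) finite_nat_set_iff_bounded by blast
  have "cylinder f m \<subseteq> Pi\<^sub>E UNIV V"
  proof
    fix h assume h: "h \<in> cylinder f m"
    have "h i \<in> V i" for i
    proof (cases "V i = UNIV")
      case False
      with m have "i < m" by auto
      with h have "h i = f i" by (simp add: cylinder_def)
      with V(1) show ?thesis by (auto simp: PiE_def)
    qed auto
    then show "h \<in> Pi\<^sub>E UNIV V" by auto
  qed
  from this V(3) have "cylinder f m \<subseteq> U" by (rule order_trans)
  then show ?thesis by (rule that)
qed

text \<open>Cylinders form a base, and an open set that misses \<open>S\<close> also misses its
  closure. Asking for \<open>m \<le> m'\<close> is harmless because longer prefixes give smaller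
  cylinders; later arguments use it to make the prefix reach past a given coordinate.\<close>

lemma nowhere_dense_iff_cylinder:
  fixes S :: "(nat \<Rightarrow> 'a::discrete_topology) set"
  shows "nowhere_dense S \<longleftrightarrow>
    (\<forall>f m. \<exists>g m'. m \<le> m' \<and> g \<in> cylinder f m \<and> cylinder g m' \<inter> S = {})"
    (is "_ \<longleftrightarrow> ?R")
proof
  assume S: "nowhere_dense S"
  show ?R
  proof (intro allI)
    fix f :: "nat \<Rightarrow> 'a" and m
    have "\<not> cylinder f m \<subseteq> closure S"
      using S interior_maximal[OF _ open_cylinder] cylinder_self
      unfolding nowhere_dense_def by blast
    then obtain g where g: "g \<in> cylinder f m" "g \<in> - closure S" by auto
    obtain m' where "cylinder g m' \<subseteq> - closure S"
      using open_contains_cylinder[OF _ g(2)] by auto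
    moreover have "cylinder g (max m m') \<subseteq> cylinder g m'" by (auto simp: cylinder_def)
    ultimately have "cylinder g (max m m') \<inter> S = {}" using closure_subset[of S] by blast
    with g(1) show "\<exists>g m'. m \<le> m' \<and> g \<in> cylinder f m \<and> cylinder g m' \<inter> S = {}"
      by (metis max.cobounded1)
  qed
next
  assume R: ?R
  have "f \<notin> interior (closure S)" for f
  proof
    assume "f \<in> interior (closure S)"
    then obtain m where m: "cylinder f m \<subseteq> interior (closure S)"
      using open_contains_cylinder by blast
    obtain g m' where g: "g \<in> cylinder f m" "cylinder g m' \<inter> S = {}" using R by blast
    then have "cylinder g m' \<inter> closure S = {}"
      by (simp add: open_Int_closure_eq_empty[OF open_cylinder])
    then have "g \<notin> closure S" using cylinder_self by fastforce
    with m g(1) interior_subset show False by blast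
  qed
  then show "nowhere_dense S" unfolding nowhere_dense_def by blast
qed

lemma nowhere_dense_subset: "nowhere_dense T \<Longrightarrow> S \<subseteq> T \<Longrightarrow> nowhere_dense S"
  unfolding nowhere_dense_def by (metis closure_mono interior_mono subset_empty)

lemma nowhere_dense_empty: "nowhere_dense {}"
  by (simp add: nowhere_dense_def)

lemma nowhere_dense_Un:
  assumes "nowhere_dense S" "nowhere_dense T"
  shows "nowhere_dense (S \<union> T)"
  using assms interior_closed_Un_empty_interior[of "closure S" "closure T"]
  by (simp add: nowhere_dense_def)

lemma nowhere_dense_UN:
  "finite A \<Longrightarrow> (\<And>i. i \<in> A \<Longrightarrow> nowhere_dense (S i)) \<Longrightarrow> nowhere_dense (\<Union>i\<in>A. S i)"
  by (induction rule: finite_induct) (auto intro: nowhere_dense_empty nowhere_dense_Un)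

text \<open>Overwriting by \<open>p\<close> only touches coordinates below \<open>n\<close>: refine
  the overwritten \<open>f\<close> until \<open>S\<close> is avoided, then put the values of
  \<open>f\<close> back below \<open>n\<close>.\<close>

lemma nowhere_dense_vimage_prefix:
  fixes S :: "(nat \<Rightarrow> 'a::discrete_topology) set"
  assumes "nowhere_dense S"
  shows "nowhere_dense {h. (\<lambda>i. if i < n then p i else h i) \<in> S}"
  unfolding nowhere_dense_iff_cylinder
proof (intro allI)
  fix f :: "nat \<Rightarrow> 'a" and m
  obtain g m' where g: "max n m \<le> m'"
      "g \<in> cylinder (\<lambda>i. if i < n then p i else f i) (max n m)" "cylinder g m' \<inter> S = {}"
    using assms unfolding nowhere_dense_iff_cylinder by blast
  let ?g = "\<lambda>i. if i < n then f i else g i"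
  have "?g \<in> cylinder f m"
    using g(2) by (auto simp: cylinder_def)
  moreover have "(\<lambda>i. if i < n then p i else h i) \<in> cylinder g m'" if "h \<in> cylinder ?g m'" for h
    using that g(2) by (auto simp: cylinder_def)
  ultimately show "\<exists>g m'. m \<le> m' \<and> g \<in> cylinder f m \<and>
      cylinder g m' \<inter> {h. (\<lambda>i. if i < n then p i else h i) \<in> S} = {}"
    using g(1,3) by (intro exI[of _ ?g] exI[of _ m']) auto
qed

text \<open>A binary sequence has only finitely many possible prefixes of length \<open>n\<close>,
  so changing members of \<open>S\<close> below \<open>n\<close> yields a finite union of sets of
  the previous kind.\<close>

lemma nowhere_dense_tail_saturation:
  fixes S :: "(nat \<Rightarrow> bool) set"
  assumes "nowhere_dense S"
  shows "nowhere_dense {h. \<exists>g\<in>S. \<forall>i\<ge>n. g i = h i}"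
proof -
  have "{h. \<exists>g\<in>S. \<forall>i\<ge>n. g i = h i}
    \<subseteq> (\<Union>p\<in>Pow {..<n}. {h. (\<lambda>i. if i < n then i \<in> p else h i) \<in> S})"
  proof clarify
    fix h g :: "nat \<Rightarrow> bool" assume g: "g \<in> S" "\<forall>i\<ge>n. g i = h i"
    then have "(\<lambda>i. if i < n then i \<in> {i. i < n \<and> g i} else h i) = g" by (simp add: fun_eq_iff)
    with g(1) show "h \<in> (\<Union>p\<in>Pow {..<n}. {h. (\<lambda>i. if i < n then i \<in> p else h i) \<in> S})"
      by (intro UN_I[of "{i. i < n \<and> g i}"]) auto
  qed
  moreover have "nowhere_dense (\<Union>p\<in>Pow {..<n}. {h. (\<lambda>i. if i < n then i \<in> p else h i) \<in> S})"
    by (intro nowhere_dense_UN nowhere_dense_vimage_prefix assms) auto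
  ultimately show ?thesis by (rule nowhere_dense_subset[rotated])
qed

text \<open>The pattern has to work whatever \<open>h\<close> does below \<open>n\<close>. It is
  therefore read off from a cylinder that misses not only \<open>S\<close> but its saturation under
  changes below \<open>n\<close>.\<close>

lemma nowhere_dense_avoiding_pattern:
  fixes S :: "(nat \<Rightarrow> bool) set"
  assumes "nowhere_dense S"
  obtains m t where "n < m" "t \<subseteq> {n..<m}" "t \<noteq> {}"
    "\<And>h. (\<forall>i\<in>{n..<m}. h i \<longleftrightarrow> i \<in> t) \<Longrightarrow> h \<notin> S"
proof -
  \<comment> \<open>Starting from the all-true prefix of length \<open>Suc n\<close> rather than
    \<open>n\<close> forces \<open>g n\<close> to be true, which makes the pattern nonempty.\<close>
  obtain g m where g: "Suc n \<le> m" "g \<in> cylinder (\<lambda>_. True) (Suc n)"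
      "cylinder g m \<inter> {h. \<exists>g\<in>S. \<forall>i\<ge>n. g i = h i} = {}"
    using nowhere_dense_tail_saturation[OF assms, of n, unfolded nowhere_dense_iff_cylinder]
    by meson
  show thesis
  proof (rule that[of m "{i \<in> {n..<m}. g i}"])
    have "n \<in> {i \<in> {n..<m}. g i}" using g(1,2) by (simp add: cylinder_def)
    then show "n < m" "{i \<in> {n..<m}. g i} \<noteq> {}" by auto
    show "h \<notin> S" if h: "\<forall>i\<in>{n..<m}. h i \<longleftrightarrow> i \<in> {i \<in> {n..<m}. g i}" for h
    proof
      assume "h \<in> S"
      \<comment> \<open>Taking the values of \<open>g\<close> below \<open>n\<close> moves
        \<open>h\<close> into the avoided cylinder, while the unchanged tail keeps it in the
        saturation of \<open>S\<close>.\<close>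
      let ?h = "\<lambda>i. if i < n then g i else h i"
      have "?h \<in> cylinder g m" using h by (auto simp: cylinder_def)
      moreover have "\<exists>g\<in>S. \<forall>i\<ge>n. g i = ?h i" using \<open>h \<in> S\<close> by auto
      ultimately show False using g(3) by blast
    qed
  qed auto
qed

section \<open>Countable covers by nowhere dense sets\<close>

lemma meager_subset_UN:
  assumes "\<And>n::nat. nowhere_dense (C n)" "S \<subseteq> (\<Union>n. C n)"
  shows "meager S"
  unfolding meager_def
proof (intro exI conjI)
  \<comment> \<open>The definition of \<open>meager\<close> asks for an equality rather than a
    cover, hence the intersections with \<open>S\<close>.\<close>
  show "countable (range (\<lambda>n. S \<inter> C n))" by simp
  show "\<forall>N\<in>range (\<lambda>n. S \<inter> C n). nowhere_dense N"
    using assms(1) by (auto intro: nowhere_dense_subset)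
  show "S = \<Union> (range (\<lambda>n. S \<inter> C n))" using assms(2) by auto
qed

text \<open>Finite unions of an enumeration make the cover increasing, so that a point outside
  \<open>M k\<close> for infinitely many \<open>k\<close> is outside every
  \<open>M k\<close>.\<close>

lemma meager_increasing_cover:
  assumes "meager S"
  obtains M :: "nat \<Rightarrow> 'a::topological_space set"
  where "\<forall>k. nowhere_dense (M k)" "mono M" "S \<subseteq> (\<Union>k. M k)"
proof -
  obtain \<N> where \<N>: "countable \<N>" "\<forall>N\<in>\<N>. nowhere_dense N" "S = \<Union>\<N>"
    using assms unfolding meager_def by blast
  \<comment> \<open>Inserting the empty set, itself nowhere dense, guarantees a nonempty family to
    enumerate.\<close>
  define N where "N = from_nat_into (insert {} \<N>)"
  have range_N: "range N = insert {} \<N>"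
    unfolding N_def using \<N>(1) by (intro range_from_nat_into) auto
  then have nd: "nowhere_dense (N k)" for k
    using \<N>(2) nowhere_dense_empty by (metis insertE rangeI)
  show thesis
  proof
    show "\<forall>k. nowhere_dense (\<Union>j\<le>k. N j)"
      by (intro allI nowhere_dense_UN nd) auto
    show "mono (\<lambda>k. \<Union>j\<le>k. N j)" by (force simp: mono_def)
    have "S \<subseteq> \<Union> (range N)" using range_N \<N>(3) by auto
    then show "S \<subseteq> (\<Union>k. \<Union>j\<le>k. N j)" by blast
  qed
qed

lemma downward_closedD:
  "downward_closed X \<Longrightarrow> x \<in> X \<Longrightarrow> infinite y \<Longrightarrow> y \<subseteq> x \<Longrightarrow> y \<in> X"
  unfolding downward_closed_def almost_subset_def by (metis Diff_eq_empty_iff finite.emptyI)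

section \<open>Interval partitions of the natural numbers\<close>

lemma interval_partition_strict_mono:
  fixes a :: "nat \<Rightarrow> nat"
  assumes "strict_mono a" "a 0 = 0"
  shows "interval_partition (range (\<lambda>k. {a k..<a (Suc k)}))"
    and "disjoint_family (\<lambda>k. {a k..<a (Suc k)})"
proof -
  have "{a k..<a (Suc k)} \<inter> {a l..<a (Suc l)} = {}" if "k < l" for k l
    using strict_mono_less_eq[OF assms(1), of "Suc k" l] that by auto
  then show disj: "disjoint_family (\<lambda>k. {a k..<a (Suc k)})"
    unfolding disjoint_family_on_def by (metis Int_commute nat_neq_iff)
  have "\<exists>k. i \<in> {a k..<a (Suc k)}" for i
  proof -
    \<comment> \<open>The first \<open>k\<close> intervals cover everything below
      \<open>a k\<close>, the base case being vacuous as \<open>a 0 = 0\<close>. Since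
      \<open>i < a (Suc i)\<close>, every \<open>i\<close> is reached.\<close>
    have "i < a k \<Longrightarrow> \<exists>j. i \<in> {a j..<a (Suc j)}" for k
    proof (induction k)
      case (Suc k)
      then show ?case by (cases "i < a k") (auto simp: not_less)
    qed (use assms(2) in simp)
    moreover have "i < a (Suc i)"
      using strict_mono_imp_increasing[OF assms(1), of "Suc i"] by simp
    ultimately show ?thesis by blast
  qed
  then have "(\<Union>k. {a k..<a (Suc k)}) = UNIV" by blast
  moreover have "{} \<notin> range (\<lambda>k. {a k..<a (Suc k)})"
    using assms(1) by (auto simp: strict_mono_Suc_iff not_le)
  moreover have "disjoint (range (\<lambda>k. {a k..<a (Suc k)}))"
    using disj by (rule disjoint_family_on_disjoint_image)
  ultimately show "interval_partition (range (\<lambda>k. {a k..<a (Suc k)}))"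
    unfolding interval_partition_def partition_on_def by blast
qed

text \<open>Each point of \<open>F\<close> lies in at most one block, so the blocks in question are
  values of a function on the finite set \<open>F\<close>.\<close>

lemma interval_partition_finite_meeting:
  assumes "interval_partition P" "finite F"
  shows "finite {I \<in> P. I \<inter> F \<noteq> {}}"
proof (rule finite_subset)
  show "{I \<in> P. I \<inter> F \<noteq> {}} \<subseteq> (\<lambda>i. THE I. I \<in> P \<and> i \<in> I) ` F"
  proof clarify
    fix I assume I: "I \<in> P" "I \<inter> F \<noteq> {}"
    then obtain i where i: "i \<in> I" "i \<in> F" by blast
    have "(THE I. I \<in> P \<and> i \<in> I) = I"
    proof (rule the_equality)
      show "J = I" if "J \<in> P \<and> i \<in> J" for J
        using that assms(1) I(1) i(1)
        unfolding interval_partition_def partition_on_def disjoint_def by blast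
    qed (use I(1) i(1) in blast)
    with i(2) show "I \<in> (\<lambda>i. THE I. I \<in> P \<and> i \<in> I) ` F" by blast
  qed
qed (use assms(2) in simp)

lemma interval_partition_infinite:
  assumes "interval_partition P"
  shows "infinite P"
proof
  assume "finite P"
  moreover have "finite I" if "I \<in> P" for I
    using assms that unfolding interval_partition_def by auto
  ultimately have "finite (\<Union>P)" by (rule finite_Union)
  then show False
    using assms by (simp add: interval_partition_def partition_on_def)
qed

text \<open>Every block in \<open>Q\<close> is nonempty and so meets the union of \<open>Q\<close>;
  a finite union could meet only finitely many blocks.\<close>

lemma interval_partition_infinite_Union:
  assumes "interval_partition P" "Q \<subseteq> P" "infinite Q"
  shows "infinite (\<Union>Q)"
proof
  assume "finite (\<Union>Q)"
  then have "finite {I \<in> P. I \<inter> \<Union>Q \<noteq> {}}"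
    by (rule interval_partition_finite_meeting[OF assms(1)])
  moreover have "I \<inter> \<Union>Q \<noteq> {}" if "I \<in> Q" for I
  proof -
    have "I \<noteq> {}"
      using assms(1,2) that unfolding interval_partition_def partition_on_def by blast
    then show ?thesis using that by blast
  qed
  then have "Q \<subseteq> {I \<in> P. I \<inter> \<Union>Q \<noteq> {}}" using assms(2) by blast
  ultimately show False using assms(3) finite_subset by metis
qed

section \<open>Downward-closed sets that are not groupwise dense are meager\<close>

lemma nowhere_dense_no_late_block:
  assumes "interval_partition P"
  shows "nowhere_dense {h. \<forall>I\<in>P. I \<subseteq> {n..} \<longrightarrow> \<not> (\<forall>i\<in>I. h i)}"
  unfolding nowhere_dense_iff_cylinder
proof (intro allI)
  fix f :: "nat \<Rightarrow> bool" and m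
  have "finite {I \<in> P. I \<inter> {..<max n m} \<noteq> {}}"
    using interval_partition_finite_meeting[OF assms] by simp
  then have "\<not> P \<subseteq> {I \<in> P. I \<inter> {..<max n m} \<noteq> {}}"
    using interval_partition_infinite[OF assms] finite_subset by blast
  then obtain I where I: "I \<in> P" "I \<inter> {..<max n m} = {}" by blast
  from I(1) have "finite I" using assms unfolding interval_partition_def by auto
  then obtain b where b: "\<forall>i\<in>I. i < b" using finite_nat_set_iff_bounded by blast
  \<comment> \<open>The block \<open>I\<close> lies beyond both \<open>n\<close> and
    \<open>m\<close>, so filling it leaves the prefix of \<open>f\<close> intact. A prefix reaching
    past \<open>b\<close> then forces every \<open>h\<close> in the cylinder to be true on all of
    \<open>I\<close>.\<close>
  let ?g = "\<lambda>i. i \<in> I \<or> f i"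
  have I': "I \<subseteq> {n..}" "?g \<in> cylinder f m"
    using I(2) by (auto simp: cylinder_def disjoint_iff not_less)
  have "h \<notin> {h. \<forall>I\<in>P. I \<subseteq> {n..} \<longrightarrow> \<not> (\<forall>i\<in>I. h i)}"
    if "h \<in> cylinder ?g (max m b)" for h
  proof -
    have "\<forall>i\<in>I. h i"
      using that b by (simp add: cylinder_def less_max_iff_disj)
    with I(1) I'(1) show ?thesis by blast
  qed
  then have "cylinder ?g (max m b) \<inter>
      {h. \<forall>I\<in>P. I \<subseteq> {n..} \<longrightarrow> \<not> (\<forall>i\<in>I. h i)} = {}"
    unfolding disjoint_iff by (intro allI impI)
  with I'(2) show "\<exists>g m'. m \<le> m' \<and> g \<in> cylinder f m \<and>
      cylinder g m' \<inter> {h. \<forall>I\<in>P. I \<subseteq> {n..} \<longrightarrow> \<not> (\<forall>i\<in>I. h i)} = {}"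
    by (intro exI[of _ ?g] exI[of _ "max m b"] conjI max.cobounded1)
qed

lemma meager_if_not_groupwise_dense:
  assumes "downward_closed X" "\<not> groupwise_dense X"
  shows "meager (char_fun ` X)"
proof -
  obtain P where P: "interval_partition P" "\<And>Q. Q \<subseteq> P \<Longrightarrow> infinite Q \<Longrightarrow> \<Union>Q \<notin> X"
    using assms unfolding groupwise_dense_def by blast
  show ?thesis
  proof (rule meager_subset_UN[OF nowhere_dense_no_late_block[OF P(1)]], clarify)
    fix x assume x: "x \<in> X"
    let ?Q = "{I \<in> P. I \<subseteq> x}"
    have "finite ?Q"
    proof (rule ccontr)
      assume "infinite ?Q"
      \<comment> \<open>The union of these blocks would be an infinite subset of \<open>x\<close>,
        hence a member of \<open>X\<close>, against the choice of \<open>P\<close>.\<close>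
      moreover from this have "infinite (\<Union>?Q)"
        using interval_partition_infinite_Union[OF P(1), of ?Q] by blast
      then have "\<Union>?Q \<in> X" by (rule downward_closedD[OF assms(1) x]) blast
      ultimately show False using P(2)[of ?Q] by blast
    qed
    moreover have "finite I" if "I \<in> P" for I
      using P(1) that unfolding interval_partition_def by auto
    ultimately have "finite (\<Union>?Q)" by (intro finite_Union) auto
    \<comment> \<open>All blocks inside \<open>x\<close> end before \<open>n\<close>, so no nonempty
      block starting at \<open>n\<close> or later can be contained in \<open>x\<close>.\<close>
    then obtain n where n: "\<forall>i\<in>\<Union>?Q. i < n" using finite_nat_set_iff_bounded by blast
    have "\<not> I \<subseteq> x" if "I \<in> P" "I \<subseteq> {n..}" for I
    proof
      assume "I \<subseteq> x"
      have "I \<noteq> {}"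
        using P(1) that(1) unfolding interval_partition_def partition_on_def by blast
      then obtain i where "i \<in> I" by blast
      moreover from this have "i \<in> \<Union>?Q" using that(1) \<open>I \<subseteq> x\<close> by blast
      ultimately show False using n that(2) by (meson atLeast_iff not_less subsetD)
    qed
    then have "\<forall>I\<in>P. I \<subseteq> {n..} \<longrightarrow> \<not> (\<forall>i\<in>I. char_fun x i)"
      unfolding char_fun_def by (metis subsetI)
    then show "char_fun x \<in> (\<Union>n. {h. \<forall>I\<in>P. I \<subseteq> {n..} \<longrightarrow> \<not> (\<forall>i\<in>I. h i)})"
      by (intro UN_I[OF UNIV_I] CollectI)
  qed
qed

section \<open>Meager downward-closed sets are not groupwise dense\<close>

lemma not_groupwise_dense_if_meager:
  assumes "downward_closed X" "meager (char_fun ` X)"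
  shows "\<not> groupwise_dense X"
proof
  assume gd: "groupwise_dense X"
  obtain M :: "nat \<Rightarrow> (nat \<Rightarrow> bool) set" where M:
    "\<forall>k. nowhere_dense (M k)" "mono M" "char_fun ` X \<subseteq> (\<Union>k. M k)"
    using meager_increasing_cover[OF assms(2)] .
  define avoids where "avoids k n m t \<longleftrightarrow> n < m \<and> t \<subseteq> {n..<m} \<and> t \<noteq> {} \<and>
      (\<forall>h. (\<forall>i\<in>{n..<m}. h i \<longleftrightarrow> i \<in> t) \<longrightarrow> h \<notin> M k)" for k n m t
  have "\<exists>m t. avoids k n m t" for k n
    using nowhere_dense_avoiding_pattern[OF M(1)[rule_format, of k], of n]
    unfolding avoids_def by metis
  \<comment> \<open>The choice is made for every stage \<open>k\<close> and every left endpoint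
    \<open>n\<close> at once, because the endpoints actually used are only fixed by the recursion
    that follows.\<close>
  then obtain m t where mt: "\<And>k n. avoids k n (m k n) (t k n)"
    by metis
  \<comment> \<open>The recursor passes the stage and the previous endpoint to \<open>m\<close>, so
    consecutive intervals abut and the first one starts at 0.\<close>
  define a where "a = rec_nat 0 m"
  have a0: "a 0 = 0" and a_Suc: "a (Suc k) = m k (a k)" for k
    by (simp_all add: a_def)
  define I where "I k = {a k..<a (Suc k)}" for k
  define s where "s k = t k (a k)" for k
  have s: "s k \<subseteq> I k" "s k \<noteq> {}" "\<And>h. (\<forall>i\<in>I k. h i \<longleftrightarrow> i \<in> s k) \<Longrightarrow> h \<notin> M k" for k
    using mt[of k "a k"] by (auto simp: avoids_def s_def I_def a_Suc)
  have "strict_mono a" using mt by (simp add: avoids_def strict_mono_Suc_iff a_Suc)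
  note I = interval_partition_strict_mono[OF this a0, folded I_def]
  obtain Q where Q: "Q \<subseteq> range I" "infinite Q" "\<Union>Q \<in> X"
    using gd I(1) unfolding groupwise_dense_def by blast
  define A where "A = {k. I k \<in> Q}"
  have "Q = I ` A" using Q(1) by (auto simp: A_def)
  with Q(2) have "infinite A" using finite_imageI by metis
  define y where "y = (\<Union>k\<in>A. s k)"
  have I_unique: "k = l" if "i \<in> I k" "i \<in> I l" for i k l
    using disjoint_family_onD[OF I(2), of k l] that by blast
  \<comment> \<open>Patterns of other indices live in disjoint intervals and contribute nothing to
    \<open>I k\<close>.\<close>
  have trace: "i \<in> y \<longleftrightarrow> i \<in> s k" if "k \<in> A" "i \<in> I k" for i k
  proof
    assume "i \<in> y"
    then obtain l where "i \<in> s l" unfolding y_def by blast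
    moreover from this have "i \<in> I l" using s(1) by (rule subsetD[rotated])
    ultimately show "i \<in> s k" using I_unique that(2) by metis
  qed (use that(1) y_def in blast)
  have "infinite y"
    unfolding y_def
  proof (rule infinite_disjoint_family_imp_infinite_UNION[OF \<open>infinite A\<close>])
    show "s k \<noteq> {}" for k by (rule s(2))
    show "disjoint_family_on s A"
      using I_unique s(1) unfolding disjoint_family_on_def disjoint_iff by (meson subsetD)
  qed
  moreover have "y \<subseteq> \<Union>Q" unfolding y_def \<open>Q = I ` A\<close> by (intro UN_mono order_refl s(1))
  ultimately have "y \<in> X" by (rule downward_closedD[OF assms(1) Q(3)])
  then obtain j where j: "char_fun y \<in> M j" using M(3) by blast
  \<comment> \<open>The index \<open>j\<close> need not belong to \<open>A\<close>, but some larger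
    \<open>k\<close> does, and monotonicity carries membership from \<open>M j\<close> to
    \<open>M k\<close>.\<close>
  obtain k where k: "k \<in> A" "j \<le> k"
    using \<open>infinite A\<close> by (meson infinite_nat_iff_unbounded_le)
  have "char_fun y \<notin> M k"
    using trace[OF k(1)] by (intro s(3)) (simp add: char_fun_def)
  moreover have "M j \<subseteq> M k" using M(2) k(2) by (rule monoD)
  ultimately show False using j by (meson subsetD)
qed

theorem theorem1:
  fixes X :: "nat set set"
  assumes "downward_closed X"
  shows "meager (char_fun ` X) \<longleftrightarrow> \<not> groupwise_dense X"
  using assms meager_if_not_groupwise_dense not_groupwise_dense_if_meager by blast

end
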